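(* Fix an integer $d\ge 1$. The simplicial Hausdorff distance for filtered complexes, $\hat\delta$, is an extended metric, where filtered complexes are identified when they are isomorphic. That is, $\hat\delta$ takes values in $[0,\infty]$ and for all filtered complexes $(X,f),(Y,g),(Z,h)$ with measurement functions in $\mathbb{R}^d$: (1) $\hat\delta((X,f),(Y,g))\ge 0$, and $\hat\delta((X,f),(Y,g))=0$ if and only if $(X,f)$ and $(Y,g)$ are isomorphic; (2) $\hat\delta((X,f),(Y,g))=\hat\delta((Y,g),(X,f))$; (3) $\hat\delta((X,f),(Z,h))\le\hat\delta((X,f),(Y,g))+\hat\delta((Y,g),(Z,h))$.
   Context: $\mathbb{X}^d$ is the class of pairs $(X,f)$ where $X$ is a finite abstract simplicial complex with vertex set $X_0$ (every vertex is a $0$-simplex of $X$; simplices are nonempty) and $f:X_0\to\mathbb{R}^d$ is an injective function (the measurement function). $d(\cdot,\cdot)$ denotes Euclidean distance in $\mathbb{R}^d$. For $\epsilon>0$, $(X,f)\in\mathbb{X}^d$ is $\epsilon$-close to $(Y,g)\in\mathbb{X}^d$ if for every $k$ and every $k$-simplex $\sigma\in X$ there is a $k$-simplex $\tau\in Y$ such that for every vertex $v\in\sigma$ there is a vertex $w\in\tau$ with $d(f(v),g(w))<\epsilon$. The directed distance is $\vec d((X,f),(Y,g))=\inf\{\epsilon>0:(X,f)\text{ is }\epsilon\text{-close to }(Y,g)\}\in[0,\infty]$, with $\inf\emptyset=+\infty$. Two pairs $(X,f),(Y,g)\in\mathbb{X}^d$ are isomorphic if there is a bijection $\phi_0:X_0\to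 Y_0$ with $g\circ\phi_0=f$ that induces a dimension-preserving bijection $\sigma\mapsto\phi_0(\sigma)$ from the simplices of $X$ to the simplices of $Y$. Filtered complex: a pair $(X,f)$ consisting of a family $(X_\alpha)_{\alpha>0}$ of simplicial complexes on the vertex set $X_0$ such that $X_\alpha$ is a subcomplex of $X_\beta$ whenever $\alpha\le\beta$, together with an injective $f:X_0\to\mathbb{R}^d$, such that $(X_\alpha,f)\in\mathbb{X}^d$ for every $\alpha>0$. Two filtered complexes $(X,f)$ and $(Y,g)$ are isomorphic if $(X_\alpha,f)\cong(Y_\alpha,g)$ for every $\alpha>0$. Directed distance for filtered complexes: $\vec{\mathsf d}((X,f),(Y,g))=\sup_{\alpha>0}\vec d((X_\alpha,f),(Y_\alpha,g))$. Simplicial Hausdorff distance for filtered complexes: $\hat\delta((X,f),(Y,g))=\max\{\vec{\mathsf d}((X,f),(Y,g)),\vec{\mathsf d}((Y,g),(X,f))\}$. *)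

theory Defs
  imports "HOL-Analysis.Analysis"
begin

text \<open>
  A pair \<open>(X, f)\<close>, with the vertex set \<open>X\<^sub>0\<close> recorded explicitly. The Euclidean space
  of dimension \<open>d \<ge> 1\<close> is \<^typ>\<open>real ^ 'n\<close> with \<open>d = CARD('n)\<close>. The measurement is a total
  function, but only its values on the vertex set are ever used.
\<close>
record ('v, 'n) measured_complex =
  vertices :: "'v set"
  simplices :: "'v set set"
  measurement :: "'v \<Rightarrow> real ^ 'n"

definition finite_simplicial_complex :: "'v set \<Rightarrow> 'v set set \<Rightarrow> bool" where
  "finite_simplicial_complex V S \<longleftrightarrow>
     finite V \<and>
     (\<forall>\<sigma>\<in>S. \<sigma> \<noteq> {} \<and> \<sigma> \<subseteq> V) \<and>
     (\<forall>v\<in>V. {v} \<in> S) \<and>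
     (\<forall>\<sigma>\<in>S. \<forall>\<tau>. \<tau> \<noteq> {} \<and> \<tau> \<subseteq> \<sigma> \<longrightarrow> \<tau> \<in> S)"

text \<open>Note that the empty complex is allowed.\<close>
definition is_measured_complex :: "('v, 'n::finite) measured_complex \<Rightarrow> bool" where
  "is_measured_complex A \<longleftrightarrow>
     finite_simplicial_complex (vertices A) (simplices A) \<and>
     inj_on (measurement A) (vertices A)"

definition is_simplex :: "nat \<Rightarrow> ('v, 'n::finite) measured_complex \<Rightarrow> 'v set \<Rightarrow> bool" where
  "is_simplex k A \<sigma> \<longleftrightarrow> \<sigma> \<in> simplices A \<and> card \<sigma> = k + 1"

definition eps_close ::
  "real \<Rightarrow> ('v, 'n::finite) measured_complex \<Rightarrow> ('w, 'n) measured_complex \<Rightarrow> bool" where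
  "eps_close \<epsilon> A B \<longleftrightarrow>
     (\<forall>k \<sigma>. is_simplex k A \<sigma> \<longrightarrow>
        (\<exists>\<tau>. is_simplex k B \<tau> \<and>
           (\<forall>v\<in>\<sigma>. \<exists>w\<in>\<tau>. dist (measurement A v) (measurement B w) < \<epsilon>)))"

text \<open>The infimum is taken in \<^typ>\<open>ereal\<close>, so that it is \<open>\<infinity>\<close> over the empty set.\<close>
definition directed_dist ::
  "('v, 'n::finite) measured_complex \<Rightarrow> ('w, 'n) measured_complex \<Rightarrow> ereal" where
  "directed_dist A B = (INF \<epsilon>\<in>{\<epsilon>. \<epsilon> > 0 \<and> eps_close \<epsilon> A B}. ereal \<epsilon>)"

definition measured_complex_iso ::
  "('v, 'n::finite) measured_complex \<Rightarrow> ('w, 'n) measured_complex \<Rightarrow> bool" where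
  "measured_complex_iso A B \<longleftrightarrow>
     (\<exists>\<phi>. bij_betw \<phi> (vertices A) (vertices B) \<and>
          (\<forall>v\<in>vertices A. measurement B (\<phi> v) = measurement A v) \<and>
          bij_betw (\<lambda>\<sigma>. \<phi> ` \<sigma>) (simplices A) (simplices B) \<and>
          (\<forall>k \<sigma>. is_simplex k A \<sigma> \<longrightarrow> is_simplex k B (\<phi> ` \<sigma>)))"

text \<open>
  The family \<open>(X\<^sub>\<alpha>)\<close> is indexed by all reals for convenience; its values at \<open>\<alpha> \<le> 0\<close> are
  ignored throughout.
\<close>
record ('v, 'n) filtered_complex =
  fvertices :: "'v set"
  fsimplices :: "real \<Rightarrow> 'v set set"
  fmeasurement :: "'v \<Rightarrow> real ^ 'n"

definition level ::
  "('v, 'n::finite) filtered_complex \<Rightarrow> real \<Rightarrow> ('v, 'n) measured_complex" where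
  "level X \<alpha> =
     \<lparr>vertices = fvertices X, simplices = fsimplices X \<alpha>, measurement = fmeasurement X\<rparr>"

definition is_filtered_complex :: "('v, 'n::finite) filtered_complex \<Rightarrow> bool" where
  "is_filtered_complex X \<longleftrightarrow>
     (\<forall>\<alpha>>0. is_measured_complex (level X \<alpha>)) \<and>
     (\<forall>\<alpha> \<beta>. 0 < \<alpha> \<and> \<alpha> \<le> \<beta> \<longrightarrow> fsimplices X \<alpha> \<subseteq> fsimplices X \<beta>)"

definition filtered_iso ::
  "('v, 'n::finite) filtered_complex \<Rightarrow> ('w, 'n) filtered_complex \<Rightarrow> bool" where
  "filtered_iso X Y \<longleftrightarrow> (\<forall>\<alpha>>0. measured_complex_iso (level X \<alpha>) (level Y \<alpha>))"

definition filtered_directed_dist ::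
  "('v, 'n::finite) filtered_complex \<Rightarrow> ('w, 'n) filtered_complex \<Rightarrow> ereal" where
  "filtered_directed_dist X Y = (SUP \<alpha>\<in>{0<..}. directed_dist (level X \<alpha>) (level Y \<alpha>))"

definition filtered_hausdorff_dist ::
  "('v, 'n::finite) filtered_complex \<Rightarrow> ('w, 'n) filtered_complex \<Rightarrow> ereal" where
  "filtered_hausdorff_dist X Y =
     max (filtered_directed_dist X Y) (filtered_directed_dist Y X)"

end

theory Submission
  imports Defs
begin

text \<open>
  The sets of points in \<open>\<real>\<^sup>d\<close> spanned by the simplices of a measured complex determine it up
  to isomorphism. The vertex sets being finite, for \<open>\<epsilon>\<close> below all positive distances between
  the measurements of two complexes, \<open>\<epsilon>\<close>-closeness forces each point set of the first complex
  to lie in, hence (same cardinality, injective measurements) to equal, a point set of the second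
  one. So both directed distances vanish iff the point sets agree. The triangle inequality holds
  since \<open>\<epsilon>\<close>-closeness composes additively.
\<close>

definition point_sets :: "('v, 'n::finite) measured_complex \<Rightarrow> (real ^ 'n) set set" where
  "point_sets A = (\<lambda>\<sigma>. measurement A ` \<sigma>) ` simplices A"

section \<open>Simplices of a single measured complex\<close>

lemma measured_complexD:
  assumes "is_measured_complex A"
  shows "finite (vertices A)" "\<sigma> \<in> simplices A \<Longrightarrow> \<sigma> \<noteq> {}" "\<sigma> \<in> simplices A \<Longrightarrow> \<sigma> \<subseteq> vertices A"
    "v \<in> vertices A \<Longrightarrow> {v} \<in> simplices A" "inj_on (measurement A) (vertices A)"
  using assms by (auto simp: is_measured_complex_def finite_simplicial_complex_def)

lemma simplex_inj_on:
  assumes "is_measured_complex A" "\<sigma> \<in> simplices A"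
  shows "inj_on (measurement A) \<sigma>"
  using measured_complexD(3,5)[OF assms(1)] assms(2) by (meson inj_on_subset)

lemma simplex_finite:
  assumes "is_measured_complex A" "\<sigma> \<in> simplices A"
  shows "finite \<sigma>"
  using measured_complexD(1,3)[OF assms(1)] assms(2) by (meson finite_subset)

text \<open>Simplices are finite and nonempty, so the truncated subtraction loses nothing. This
  makes \<open>eps_close\<close>, which quantifies over dimensions, applicable to an arbitrary
  simplex.\<close>

lemma is_simplex_card:
  assumes "is_measured_complex A" "\<sigma> \<in> simplices A"
  shows "is_simplex (card \<sigma> - 1) A \<sigma>"
  using simplex_finite[OF assms] measured_complexD(2)[OF assms] assms(2)
  by (auto simp: is_simplex_def card_gt_0_iff Suc_leI)

section \<open>Closeness and the directed distance between two complexes\<close>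

lemma eps_close_mono:
  assumes "eps_close \<epsilon> A B" "\<epsilon> \<le> \<delta>"
  shows "eps_close \<delta> A B"
  using assms unfolding eps_close_def by (meson less_le_trans)

lemma eps_close_trans:
  assumes "eps_close \<epsilon> A B" "eps_close \<delta> B C"
  shows "eps_close (\<epsilon> + \<delta>) A C"
  unfolding eps_close_def
proof (intro allI impI)
  fix k \<sigma>
  assume "is_simplex k A \<sigma>"
  then obtain \<tau> where \<tau>: "is_simplex k B \<tau>"
    "\<forall>v\<in>\<sigma>. \<exists>w\<in>\<tau>. dist (measurement A v) (measurement B w) < \<epsilon>"
    using assms(1) unfolding eps_close_def by blast
  then obtain \<rho> where \<rho>: "is_simplex k C \<rho>"
    "\<forall>v\<in>\<tau>. \<exists>w\<in>\<rho>. dist (measurement B v) (measurement C w) < \<delta>"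
    using assms(2) unfolding eps_close_def by blast
  have "\<exists>u\<in>\<rho>. dist (measurement A v) (measurement C u) < \<epsilon> + \<delta>" if "v \<in> \<sigma>" for v
    using \<tau>(2) \<rho>(2) that by (meson add_strict_mono dist_triangle le_less_trans)
  with \<rho>(1) show "\<exists>\<rho>. is_simplex k C \<rho> \<and>
      (\<forall>v\<in>\<sigma>. \<exists>u\<in>\<rho>. dist (measurement A v) (measurement C u) < \<epsilon> + \<delta>)"
    by blast
qed

lemma directed_dist_nonneg: "0 \<le> directed_dist A B"
  unfolding directed_dist_def by (rule INF_greatest) auto

lemma directed_dist_triangle:
  "directed_dist A C \<le> directed_dist A B + directed_dist B C"
proof -
  have *: "directed_dist A C \<le> ereal \<epsilon> + ereal \<delta>"
    if "\<epsilon> > 0" "eps_close \<epsilon> A B" "\<delta> > 0" "eps_close \<delta> B C" for \<epsilon> \<delta>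
    unfolding directed_dist_def
    by (rule INF_lower2[of "\<epsilon> + \<delta>"]) (use that eps_close_trans in auto)
  \<comment> \<open>The infima are taken one variable at a time: here over \<delta> with \<epsilon>
    fixed, below over \<epsilon>. Each time the fixed summand is moved to the left as a subtrahend,
    so that \<open>INF_greatest\<close> applies.\<close>
  have **: "directed_dist A C \<le> ereal \<epsilon> + directed_dist B C" if "\<epsilon> > 0" "eps_close \<epsilon> A B" for \<epsilon>
  proof -
    have "directed_dist A C - ereal \<epsilon> \<le> directed_dist B C"
      unfolding directed_dist_def[of B C]
      by (rule INF_greatest) (use *[OF that] in \<open>simp add: ereal_minus_le add.commute\<close>)
    then show ?thesis
      by (simp add: ereal_minus_le add.commute)
  qed
  show ?thesis
  \<comment> \<open>Moving a summand across the inequality is safe in \<open>ereal\<close> only if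
    it is finite. The value \<infinity> makes the right side infinite, and the value -\<infinity>
    contradicts nonnegativity.\<close>
  proof (cases "directed_dist B C")
    case (real r)
    have "directed_dist A C - ereal r \<le> directed_dist A B"
      unfolding directed_dist_def[of A B]
      by (rule INF_greatest) (use ** real in \<open>simp add: ereal_minus_le\<close>)
    then show ?thesis
      by (simp add: ereal_minus_le real)
  next
    case PInf
    then show ?thesis
      using directed_dist_nonneg[of A B] by simp
  next
    case MInf
    then show ?thesis
      using directed_dist_nonneg[of B C] by simp
  qed
qed

text \<open>The set of admissible \<epsilon> is upward closed, so its infimum is 0 exactly when it
  contains every positive real.\<close>

lemma directed_dist_eq_0_iff_eps_close:
  "directed_dist A B = 0 \<longleftrightarrow> (\<forall>\<epsilon>>0. eps_close \<epsilon> A B)"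
proof
  assume zero: "directed_dist A B = 0"
  show "\<forall>\<epsilon>>0. eps_close \<epsilon> A B"
  proof (intro allI impI)
    fix \<epsilon> :: real
    assume "\<epsilon> > 0"
    then have "directed_dist A B < ereal \<epsilon>"
      using zero by simp
    then obtain \<delta> where "eps_close \<delta> A B" "\<delta> < \<epsilon>"
      unfolding directed_dist_def INF_less_iff by auto
    then show "eps_close \<epsilon> A B"
      using eps_close_mono less_imp_le by blast
  qed
next
  assume close: "\<forall>\<epsilon>>0. eps_close \<epsilon> A B"
  have "directed_dist A B \<le> 0 + ereal \<epsilon>" if "\<epsilon> > 0" for \<epsilon>
    unfolding directed_dist_def by (rule INF_lower2[of \<epsilon>]) (use close that in auto)
  then have "directed_dist A B \<le> 0"
    using ereal_le_epsilon2 by blast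
  then show "directed_dist A B = 0"
    using directed_dist_nonneg antisym by blast
qed

section \<open>Vanishing of the directed distance as inclusion of point sets\<close>

lemma finite_separation:
  fixes S T :: "'m::metric_space set"
  assumes "finite S" "finite T"
  obtains \<epsilon> where "\<epsilon> > 0" "\<And>x y. x \<in> S \<Longrightarrow> y \<in> T \<Longrightarrow> dist x y < \<epsilon> \<Longrightarrow> x = y"
proof -
  \<comment> \<open>The element 1 keeps \<open>D\<close> nonempty, so that \<open>Min D\<close>
    makes sense even when no distance is positive.\<close>
  define D where "D = insert 1 {d \<in> (\<lambda>(x, y). dist x y) ` (S \<times> T). d > 0}"
  have D: "finite D" "D \<noteq> {}" "\<forall>d\<in>D. d > 0"
    using assms by (auto simp: D_def)
  show thesis
  proof
    show "Min D > 0"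
      using D by simp
    fix x y
    assume "x \<in> S" "y \<in> T" "dist x y < Min D"
    then show "x = y"
      using Min_le[OF D(1), of "dist x y"] by (force simp: D_def)
  qed
qed

lemma directed_dist_eq_0_iff:
  assumes A: "is_measured_complex A" and B: "is_measured_complex B"
  shows "directed_dist A B = 0 \<longleftrightarrow> point_sets A \<subseteq> point_sets B"
proof
  assume "directed_dist A B = 0"
  then have close: "\<forall>\<epsilon>>0. eps_close \<epsilon> A B"
    by (simp add: directed_dist_eq_0_iff_eps_close)
  \<comment> \<open>The separation is taken over the images of all vertices, so one \<epsilon>
    serves every simplex.\<close>
  obtain \<epsilon> where \<epsilon>: "\<epsilon> > 0" "\<And>x y. x \<in> measurement A ` vertices A \<Longrightarrow>
      y \<in> measurement B ` vertices B \<Longrightarrow> dist x y < \<epsilon> \<Longrightarrow> x = y"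
    using measured_complexD(1)[OF A] measured_complexD(1)[OF B] finite_separation
    by (metis finite_imageI)
  show "point_sets A \<subseteq> point_sets B"
    unfolding point_sets_def
  proof (rule image_subsetI)
    fix \<sigma>
    assume \<sigma>: "\<sigma> \<in> simplices A"
    have "eps_close \<epsilon> A B"
      using close \<epsilon>(1) by blast
    then obtain \<tau> where "is_simplex (card \<sigma> - 1) B \<tau>" and
      near: "\<forall>v\<in>\<sigma>. \<exists>w\<in>\<tau>. dist (measurement A v) (measurement B w) < \<epsilon>"
      using is_simplex_card[OF A \<sigma>] unfolding eps_close_def by blast
    then have \<tau>: "\<tau> \<in> simplices B" "card \<tau> = card \<sigma>"
      using is_simplex_card[OF A \<sigma>] by (auto simp: is_simplex_def)
    have "measurement A ` \<sigma> \<subseteq> measurement B ` \<tau>"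
    proof (rule image_subsetI)
      fix v
      assume "v \<in> \<sigma>"
      then obtain w where "w \<in> \<tau>" "dist (measurement A v) (measurement B w) < \<epsilon>"
        using near by blast
      moreover have "v \<in> vertices A" "w \<in> vertices B"
        using measured_complexD(3)[OF A \<sigma>] measured_complexD(3)[OF B \<tau>(1)] \<open>v \<in> \<sigma>\<close> \<open>w \<in> \<tau>\<close>
        by auto
      ultimately show "measurement A v \<in> measurement B ` \<tau>"
        using \<epsilon>(2) by blast
    qed
    \<comment> \<open>Nearness alone gives containment. Equality comes from counting:
      \<open>eps_close\<close> preserves the dimension, and the measurements are injective on
      simplices.\<close>
    moreover have "card (measurement A ` \<sigma>) = card (measurement B ` \<tau>)"
      using card_image[OF simplex_inj_on[OF A \<sigma>]] card_image[OF simplex_inj_on[OF B \<tau>(1)]] \<tau>(2)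
      by simp
    ultimately have "measurement A ` \<sigma> = measurement B ` \<tau>"
      using simplex_finite[OF B \<tau>(1)] by (simp add: card_subset_eq)
    then show "measurement A ` \<sigma> \<in> (\<lambda>\<tau>. measurement B ` \<tau>) ` simplices B"
      using \<tau>(1) by blast
  qed
next
  assume sub: "point_sets A \<subseteq> point_sets B"
  have "eps_close \<epsilon> A B" if "\<epsilon> > 0" for \<epsilon>
    unfolding eps_close_def
  proof (intro allI impI)
    fix k \<sigma>
    assume "is_simplex k A \<sigma>"
    then have \<sigma>: "\<sigma> \<in> simplices A" "card \<sigma> = k + 1"
      by (auto simp: is_simplex_def)
    have "measurement A ` \<sigma> \<in> point_sets B"
      using sub \<sigma>(1) by (auto simp: point_sets_def)
    then obtain \<tau> where \<tau>: "\<tau> \<in> simplices B" "measurement A ` \<sigma> = measurement B ` \<tau>"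
      unfolding point_sets_def by (rule imageE)
    \<comment> \<open>Injectivity makes the common point set determine the dimension, so \<tau> is
      an admissible partner of \<sigma>; as the points coincide, it works for every
      \<epsilon>.\<close>
    then have "card \<tau> = card \<sigma>"
      using card_image[OF simplex_inj_on[OF A \<sigma>(1)]] card_image[OF simplex_inj_on[OF B \<tau>(1)]]
      by simp
    then have "is_simplex k B \<tau>"
      using \<tau>(1) \<sigma>(2) by (simp add: is_simplex_def)
    moreover have "\<exists>w\<in>\<tau>. dist (measurement A v) (measurement B w) < \<epsilon>" if "v \<in> \<sigma>" for v
    proof -
      obtain w where "w \<in> \<tau>" "measurement A v = measurement B w"
        using \<tau>(2) \<open>v \<in> \<sigma>\<close> by blast
      then show ?thesis
        using \<open>\<epsilon> > 0\<close> by (intro bexI[of _ w]) auto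
    qed
    ultimately show "\<exists>\<tau>. is_simplex k B \<tau> \<and>
        (\<forall>v\<in>\<sigma>. \<exists>w\<in>\<tau>. dist (measurement A v) (measurement B w) < \<epsilon>)"
      by blast
  qed
  then show "directed_dist A B = 0"
    by (simp add: directed_dist_eq_0_iff_eps_close)
qed

section \<open>Isomorphism as equality of point sets\<close>

lemma Union_point_sets:
  assumes "is_measured_complex A"
  shows "\<Union> (point_sets A) = measurement A ` vertices A"
proof
  show "\<Union> (point_sets A) \<subseteq> measurement A ` vertices A"
    using measured_complexD(3)[OF assms] by (fastforce simp: point_sets_def)
  show "measurement A ` vertices A \<subseteq> \<Union> (point_sets A)"
    using measured_complexD(4)[OF assms] by (fastforce simp: point_sets_def)
qed

text \<open>An isomorphism preserves measurements, hence point sets. Conversely, vertices are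
  matched by their measurements, and simplices are then matched because an injective measurement
  makes a set of vertices recoverable from its image.\<close>

lemma measured_complex_iso_iff:
  assumes A: "is_measured_complex A" and B: "is_measured_complex B"
  shows "measured_complex_iso A B \<longleftrightarrow> point_sets A = point_sets B"
proof
  assume "measured_complex_iso A B"
  then obtain \<phi> where \<phi>: "\<forall>v\<in>vertices A. measurement B (\<phi> v) = measurement A v"
    "bij_betw (\<lambda>\<sigma>. \<phi> ` \<sigma>) (simplices A) (simplices B)"
    unfolding measured_complex_iso_def by blast
  have "measurement B ` \<phi> ` \<sigma> = measurement A ` \<sigma>" if "\<sigma> \<in> simplices A" for \<sigma>
    unfolding image_image
    by (rule image_cong) (use \<phi>(1) measured_complexD(3)[OF A that] in auto)
  then show "point_sets A = point_sets B"
    unfolding point_sets_def bij_betw_imp_surj_on[OF \<phi>(2), symmetric] image_image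
    by simp
next
  assume eq: "point_sets A = point_sets B"
  let ?f = "measurement A" and ?g = "measurement B"
  \<comment> \<open>Compatibility with the measurements and injectivity of \<open>?g\<close> force
    this choice on the vertices of \<open>A\<close>.\<close>
  define \<phi> where "\<phi> = inv_into (vertices B) ?g \<circ> ?f"
  \<comment> \<open>Both measurements have the same image, namely the union of the common point
    sets, because every vertex is a simplex. This is what makes \<phi> a bijection.\<close>
  have f: "bij_betw ?f (vertices A) (?f ` vertices A)"
    and g: "bij_betw ?g (vertices B) (?f ` vertices A)"
    using measured_complexD(5)[OF A] measured_complexD(5)[OF B]
      Union_point_sets[OF A] Union_point_sets[OF B] eq
    by (auto simp: bij_betw_def)
  have bij: "bij_betw \<phi> (vertices A) (vertices B)"
    unfolding \<phi>_def using f bij_betw_inv_into[OF g] by (rule bij_betw_trans)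
  have meas: "?g (\<phi> v) = ?f v" if "v \<in> vertices A" for v
    using that g by (simp add: \<phi>_def bij_betw_inv_into_right)
  have img: "?g ` \<phi> ` \<sigma> = ?f ` \<sigma>" if "\<sigma> \<in> simplices A" for \<sigma>
    unfolding image_image
    by (rule image_cong) (use meas measured_complexD(3)[OF A that] in auto)
  have match: "\<phi> ` \<sigma> = \<tau>" if "\<sigma> \<in> simplices A" "\<tau> \<in> simplices B" "?f ` \<sigma> = ?g ` \<tau>" for \<sigma> \<tau>
  proof -
    have "\<phi> ` \<sigma> \<subseteq> vertices B" "\<tau> \<subseteq> vertices B"
      using bij measured_complexD(3)[OF A that(1)] measured_complexD(3)[OF B that(2)]
      by (auto simp: bij_betw_def)
    then show ?thesis
      using img[OF that(1)] that(3) measured_complexD(5)[OF B] by (simp add: inj_on_image_eq_iff)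
  qed
  have simp_img: "(\<lambda>\<sigma>. \<phi> ` \<sigma>) ` simplices A = simplices B"
  proof
    show "(\<lambda>\<sigma>. \<phi> ` \<sigma>) ` simplices A \<subseteq> simplices B"
    proof (rule image_subsetI)
      fix \<sigma>
      assume \<sigma>: "\<sigma> \<in> simplices A"
      then have "?f ` \<sigma> \<in> point_sets B"
        unfolding eq[symmetric] by (simp add: point_sets_def)
      then obtain \<tau> where "\<tau> \<in> simplices B" "?f ` \<sigma> = ?g ` \<tau>"
        unfolding point_sets_def by blast
      then show "\<phi> ` \<sigma> \<in> simplices B"
        using match[OF \<sigma>] by simp
    qed
    show "simplices B \<subseteq> (\<lambda>\<sigma>. \<phi> ` \<sigma>) ` simplices A"
    proof
      fix \<tau>
      assume \<tau>: "\<tau> \<in> simplices B"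
      then have "?g ` \<tau> \<in> point_sets A"
        unfolding eq by (simp add: point_sets_def)
      then obtain \<sigma> where "\<sigma> \<in> simplices A" "?f ` \<sigma> = ?g ` \<tau>"
        unfolding point_sets_def by (metis imageE)
      then show "\<tau> \<in> (\<lambda>\<sigma>. \<phi> ` \<sigma>) ` simplices A"
        using match[OF _ \<tau>] by blast
    qed
  qed
  have inj: "inj_on \<phi> \<sigma>" if "\<sigma> \<in> simplices A" for \<sigma>
    using bij measured_complexD(3)[OF A that] by (meson bij_betw_def inj_on_subset)
  have "inj_on (\<lambda>\<sigma>. \<phi> ` \<sigma>) (simplices A)"
    using bij measured_complexD(3)[OF A]
    by (intro inj_onI) (metis bij_betw_def inj_on_image_eq_iff)
  then have "bij_betw (\<lambda>\<sigma>. \<phi> ` \<sigma>) (simplices A) (simplices B)"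
    using simp_img by (simp add: bij_betw_def)
  \<comment> \<open>Dimension is preserved because \<phi> is injective on each simplex.\<close>
  moreover have "is_simplex k B (\<phi> ` \<sigma>)" if "is_simplex k A \<sigma>" for k \<sigma>
    using that simp_img card_image[OF inj] by (auto simp: is_simplex_def)
  ultimately show "measured_complex_iso A B"
    unfolding measured_complex_iso_def using bij meas by blast
qed

section \<open>From single levels to filtered complexes\<close>

lemma directed_dist_le_filtered:
  assumes "\<alpha> > 0"
  shows "directed_dist (level X \<alpha>) (level Y \<alpha>) \<le> filtered_directed_dist X Y"
  unfolding filtered_directed_dist_def using assms by (intro SUP_upper) simp

text \<open>The level \<alpha> = 1 shows that the supremum is over a nonempty family, and its
  members are nonnegative.\<close>

lemma filtered_directed_dist_nonneg: "0 \<le> filtered_directed_dist X Y"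
  using directed_dist_nonneg directed_dist_le_filtered[OF zero_less_one] by (rule order_trans)

text \<open>The inequality holds at each level, and bounding both summands by their suprema removes
  the dependence on \<alpha>.\<close>

lemma filtered_directed_dist_triangle:
  "filtered_directed_dist X Z \<le> filtered_directed_dist X Y + filtered_directed_dist Y Z"
  unfolding filtered_directed_dist_def[of X Z]
proof (rule SUP_least)
  fix \<alpha> :: real
  assume "\<alpha> \<in> {0<..}"
  then have "directed_dist (level X \<alpha>) (level Y \<alpha>) + directed_dist (level Y \<alpha>) (level Z \<alpha>)
      \<le> filtered_directed_dist X Y + filtered_directed_dist Y Z"
    by (intro add_mono directed_dist_le_filtered) auto
  then show "directed_dist (level X \<alpha>) (level Z \<alpha>)
      \<le> filtered_directed_dist X Y + filtered_directed_dist Y Z"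
    using directed_dist_triangle order_trans by blast
qed

lemma filtered_directed_dist_eq_0_iff:
  "filtered_directed_dist X Y = 0 \<longleftrightarrow> (\<forall>\<alpha>>0. directed_dist (level X \<alpha>) (level Y \<alpha>) = 0)"
proof
  assume "filtered_directed_dist X Y = 0"
  then show "\<forall>\<alpha>>0. directed_dist (level X \<alpha>) (level Y \<alpha>) = 0"
    using directed_dist_nonneg directed_dist_le_filtered by (metis antisym)
next
  assume "\<forall>\<alpha>>0. directed_dist (level X \<alpha>) (level Y \<alpha>) = 0"
  then have "filtered_directed_dist X Y \<le> 0"
    unfolding filtered_directed_dist_def by (intro SUP_least) simp
  then show "filtered_directed_dist X Y = 0"
    using filtered_directed_dist_nonneg antisym by blast
qed

lemma filtered_hausdorff_dist_triangle:
  "filtered_hausdorff_dist X Z \<le> filtered_hausdorff_dist X Y + filtered_hausdorff_dist Y Z"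
proof -
  have "filtered_directed_dist X Y + filtered_directed_dist Y Z
      \<le> filtered_hausdorff_dist X Y + filtered_hausdorff_dist Y Z"
    unfolding filtered_hausdorff_dist_def by (intro add_mono) auto
  \<comment> \<open>The opposite direction runs from \<open>Z\<close> through \<open>Y\<close> to
    \<open>X\<close>, so its summands must be swapped to fit the right side.\<close>
  moreover have "filtered_directed_dist Z Y + filtered_directed_dist Y X
      \<le> filtered_hausdorff_dist X Y + filtered_hausdorff_dist Y Z"
    unfolding filtered_hausdorff_dist_def add.commute[of "filtered_directed_dist Z Y"]
    by (intro add_mono) auto
  ultimately show ?thesis
    unfolding filtered_hausdorff_dist_def[of X Z]
    using filtered_directed_dist_triangle[of X Z Y] filtered_directed_dist_triangle[of Z X Y]
    by (meson max.boundedI order_trans)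
qed

text \<open>Both sides split into conditions on single levels: \<open>filtered_iso\<close> asks for
  an isomorphism at each \<alpha> separately, with no compatibility between levels. At a fixed level
  the two vanishing directed distances are the two inclusions between the point sets.\<close>

lemma filtered_hausdorff_dist_eq_0_iff:
  assumes X: "is_filtered_complex X" and Y: "is_filtered_complex Y"
  shows "filtered_hausdorff_dist X Y = 0 \<longleftrightarrow> filtered_iso X Y"
proof -
  have "filtered_hausdorff_dist X Y = 0 \<longleftrightarrow>
      filtered_directed_dist X Y = 0 \<and> filtered_directed_dist Y X = 0"
    using filtered_directed_dist_nonneg[of X Y] filtered_directed_dist_nonneg[of Y X]
    unfolding filtered_hausdorff_dist_def by (metis max.absorb1 max.absorb2 max.cobounded1
        max.cobounded2 antisym)
  also have "\<dots> \<longleftrightarrow> (\<forall>\<alpha>>0. directed_dist (level X \<alpha>) (level Y \<alpha>) = 0 \<and>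
      directed_dist (level Y \<alpha>) (level X \<alpha>) = 0)"
    by (auto simp: filtered_directed_dist_eq_0_iff)
  also have "\<dots> \<longleftrightarrow> filtered_iso X Y"
  proof -
    have "(directed_dist (level X \<alpha>) (level Y \<alpha>) = 0 \<and>
        directed_dist (level Y \<alpha>) (level X \<alpha>) = 0) \<longleftrightarrow>
        measured_complex_iso (level X \<alpha>) (level Y \<alpha>)" if "\<alpha> > 0" for \<alpha>
    proof -
      have "is_measured_complex (level X \<alpha>)" "is_measured_complex (level Y \<alpha>)"
        using X Y that by (auto simp: is_filtered_complex_def)
      then show ?thesis
        by (auto simp: directed_dist_eq_0_iff measured_complex_iso_iff)
    qed
    then show ?thesis
      unfolding filtered_iso_def by blast
  qed
  finally show ?thesis .
qed

theorem theorem2p24: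
  fixes X :: "('a, 'n::finite) filtered_complex"
    and Y :: "('b, 'n) filtered_complex"
    and Z :: "('c, 'n) filtered_complex"
  assumes "is_filtered_complex X" and "is_filtered_complex Y" and "is_filtered_complex Z"
  shows "0 \<le> filtered_hausdorff_dist X Y \<and>
         (filtered_hausdorff_dist X Y = 0 \<longleftrightarrow> filtered_iso X Y) \<and>
         filtered_hausdorff_dist X Y = filtered_hausdorff_dist Y X \<and>
         filtered_hausdorff_dist X Z
           \<le> filtered_hausdorff_dist X Y + filtered_hausdorff_dist Y Z"
proof (intro conjI)
  show "0 \<le> filtered_hausdorff_dist X Y"
    using filtered_directed_dist_nonneg[of X Y]
    by (simp add: filtered_hausdorff_dist_def le_max_iff_disj)
  show "filtered_hausdorff_dist X Y = 0 \<longleftrightarrow> filtered_iso X Y"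
    using assms(1,2) by (rule filtered_hausdorff_dist_eq_0_iff)
  show "filtered_hausdorff_dist X Y = filtered_hausdorff_dist Y X"
    by (simp add: filtered_hausdorff_dist_def max.commute)
  show "filtered_hausdorff_dist X Z \<le> filtered_hausdorff_dist X Y + filtered_hausdorff_dist Y Z"
    by (rule filtered_hausdorff_dist_triangle)
qed

end
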